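(* Let $K$ be a field, let $L$ be a finite lattice and let $L'$ be an induced sublattice of $L$. Let $S=K[x_a : a\in L]$ and $S'=K[x_a : a\in L']$, and let $I_L\subset S$ and $I_{L'}\subset S'$ be the join-meet ideals of $L$ and $L'$, respectively. Then $R'=S'/I_{L'}$ is an algebra retract of $R=S/I_L$.
   Context: For a finite lattice $L$, the join-meet ideal is $I_L=(x_ax_b-x_{a\wedge b}x_{a\vee b} : a,b\in L,\ a,b\text{ incomparable})\subset K[x_a : a\in L]$, where the polynomial ring has the standard grading. A sublattice $L'$ of $L$ is called induced if for all $a,b\in L$: whenever $a\vee b\in L'$ and $a\wedge b\in L'$, then $a\in L'$ and $b\in L'$. Given graded $K$-algebras $R'\subset R$, $R'$ is an algebra retract of $R$ if there exists a surjective homomorphism of graded $K$-algebras $\varepsilon: R\to R'$ whose restriction to $R'$ is the identity of $R'$. Here $R'$ is regarded as a subalgebra of $R$ via the natural $K$-algebra homomorphism $R'\to R$ induced by the inclusion $S'\subset S$ (being well defined and injective is part of the assertion). *)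

theory Defs
  imports
    "HOL-Algebra.Module"
    "HOL-Algebra.QuotRing"
    "HOL-Algebra.Algebraic_Closure_Type"
    "HOL-Library.Poly_Mapping"
begin

text \<open>
  HOL-Algebra has its own constants called \<open>sup\<close> and \<open>inf\<close>; the qualified names below are the
  operations of the type class of lattices.
\<close>

definition sublattice :: "'a::lattice set \<Rightarrow> bool" where
  "sublattice A \<longleftrightarrow>
    (\<forall>a\<in>A. \<forall>b\<in>A. sup_class.sup a b \<in> A \<and> inf_class.inf a b \<in> A)"

definition induced_sublattice :: "'a::lattice set \<Rightarrow> bool" where
  "induced_sublattice A \<longleftrightarrow> sublattice A \<and>
    (\<forall>a b. sup_class.sup a b \<in> A \<and> inf_class.inf a b \<in> A \<longrightarrow> a \<in> A \<and> b \<in> A)"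

text \<open>\<open>hpart R d\<close> is the homogeneous part of degree \<open>d\<close> of the graded algebra \<open>R\<close>.\<close>

record ('k, 'b) graded_alg = "('k, 'b) module" +
  hpart :: "nat \<Rightarrow> 'b set"

locale graded_algebra = algebra K R
  for K :: "('k, 'm) ring_scheme" and R :: "('k, 'b, 'n) graded_alg_scheme" +
  assumes hpart_submodule: "submodule (hpart R d) K R"
    and hpart_mult:
      "\<lbrakk>x \<in> hpart R d; y \<in> hpart R e\<rbrakk> \<Longrightarrow> x \<otimes>\<^bsub>R\<^esub> y \<in> hpart R (d + e)"
    and hpart_direct_sum:
      "x \<in> carrier R \<Longrightarrow>
        \<exists>!f. (\<forall>d. f d \<in> hpart R d) \<and> finite {d. f d \<noteq> \<zero>\<^bsub>R\<^esub>} \<and>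
             x = (\<Oplus>\<^bsub>R\<^esub>d\<in>{d. f d \<noteq> \<zero>\<^bsub>R\<^esub>}. f d)"

definition graded_algebra_hom ::
    "('k, 'm) ring_scheme \<Rightarrow> ('k, 'b, 'n) graded_alg_scheme \<Rightarrow>
     ('k, 'c, 'o) graded_alg_scheme \<Rightarrow> ('b \<Rightarrow> 'c) set" where
  "graded_algebra_hom K R T =
    {h \<in> ring_hom R T.
      (\<forall>c\<in>carrier K. \<forall>x\<in>carrier R. h (c \<odot>\<^bsub>R\<^esub> x) = c \<odot>\<^bsub>T\<^esub> h x) \<and>
      (\<forall>d. h ` hpart R d \<subseteq> hpart T d)}"

text \<open>
  \<open>R'\<close> is regarded as a graded subalgebra of \<open>R\<close> by means of the embedding \<open>\<iota>\<close>; the restriction of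
  \<open>\<epsilon>\<close> to \<open>R'\<close> is therefore \<open>\<epsilon> \<circ> \<iota>\<close>.
\<close>

definition algebra_retract ::
    "('k, 'm) ring_scheme \<Rightarrow> ('b \<Rightarrow> 'c) \<Rightarrow> ('k, 'b, 'n) graded_alg_scheme \<Rightarrow>
     ('k, 'c, 'o) graded_alg_scheme \<Rightarrow> bool" where
  "algebra_retract K \<iota> R' R \<longleftrightarrow>
    graded_algebra K R' \<and> graded_algebra K R \<and>
    \<iota> \<in> graded_algebra_hom K R' R \<and> inj_on \<iota> (carrier R') \<and>
    (\<exists>\<epsilon> \<in> graded_algebra_hom K R R'.
      \<epsilon> ` carrier R = carrier R' \<and> (\<forall>x\<in>carrier R'. \<epsilon> (\<iota> x) = x))"

definition quot_graded_alg ::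
    "('k, 'b, 'n) graded_alg_scheme \<Rightarrow> 'b set \<Rightarrow> ('k, 'b set) graded_alg" where
  "quot_graded_alg S I =
    \<lparr>carrier = carrier (S Quot I), monoid.mult = monoid.mult (S Quot I), one = monoid.one (S Quot I),
     zero = ring.zero (S Quot I), add = ring.add (S Quot I),
     module.smult = (\<lambda>c Y. \<Union>x\<in>Y. I +>\<^bsub>S\<^esub> (c \<odot>\<^bsub>S\<^esub> x)),
     hpart = (\<lambda>d. (\<lambda>x. I +>\<^bsub>S\<^esub> x) ` hpart S d)\<rparr>"

text \<open>
  A polynomial with coefficients in \<open>'k\<close> and variables indexed by \<open>'a\<close> is a finitely supported
  function from monomials to coefficients; a monomial is a finitely supported exponent function.
  \<open>poly_alg A\<close> consists of the polynomials that involve only variables \<open>x_a\<close> with \<open>a \<in> A\<close>.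
\<close>

type_synonym ('a, 'k) mpoly = "('a \<Rightarrow>\<^sub>0 nat) \<Rightarrow>\<^sub>0 'k"

definition mono_degree :: "('a \<Rightarrow>\<^sub>0 nat) \<Rightarrow> nat" where
  "mono_degree m = (\<Sum>a\<in>Poly_Mapping.keys m. Poly_Mapping.lookup m a)"

definition indet :: "'a \<Rightarrow> ('a, 'k::field) mpoly" where
  "indet a = Poly_Mapping.single (Poly_Mapping.single a 1) 1"

definition poly_alg :: "'a set \<Rightarrow> ('k::field, ('a, 'k) mpoly) graded_alg" where
  "poly_alg A =
    \<lparr>carrier = {p. \<forall>m\<in>Poly_Mapping.keys p. Poly_Mapping.keys m \<subseteq> A},
     monoid.mult = (*), one = 1, zero = 0, add = (+),
     module.smult = (\<lambda>c p. Poly_Mapping.single 0 c * p),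
     hpart = (\<lambda>d. {p. \<forall>m\<in>Poly_Mapping.keys p. Poly_Mapping.keys m \<subseteq> A \<and> mono_degree m = d})\<rparr>"

text \<open>
  For a sublattice \<open>A\<close>, the ideal is generated in \<open>poly_alg A\<close>, not in the polynomial ring of the
  ambient lattice.
\<close>

definition join_meet_ideal :: "'a::lattice set \<Rightarrow> ('a, 'k::field) mpoly set" where
  "join_meet_ideal A =
    genideal (poly_alg A)
      {indet a * indet b - indet (inf_class.inf a b) * indet (sup_class.sup a b) | a b.
        a \<in> A \<and> b \<in> A \<and> \<not> a \<le> b \<and> \<not> b \<le> a}"

definition join_meet_algebra ::
    "'a::lattice set \<Rightarrow> ('k::field, ('a, 'k) mpoly set) graded_alg" where
  "join_meet_algebra A = quot_graded_alg (poly_alg A) (join_meet_ideal A)"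

end

theory Submission
  imports Defs
begin

text \<open>
  Let \<open>e : S \<rightarrow> S'\<close> be the homomorphism that fixes \<open>x_a\<close> for \<open>a \<in> L'\<close> and sends every other
  variable to \<open>0\<close>. It is a graded left inverse of the inclusion \<open>S' \<subseteq> S\<close>, so it only has to be seen
  that both maps respect the join-meet ideals. The inclusion sends generators to generators. For
  \<open>e\<close>, consider \<open>x_a x_b - x_{a \<and> b} x_{a \<or> b}\<close>: since \<open>L'\<close> is an induced sublattice, \<open>a\<close> and \<open>b\<close>
  both lie in \<open>L'\<close> if and only if the meet and the join both do. So \<open>e\<close> either fixes both monomials,
  and the generator is one for \<open>L'\<close>, or kills both (\<open>kill_variables_binomial\<close>). The two maps
  therefore descend to the quotients, where they still compose to the identity of \<open>R'\<close>
  (\<open>algebra_retract_quot\<close>). In particular \<open>R' \<rightarrow> R\<close> is injective, that is,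
  \<open>I_L \<inter> S' = I_{L'}\<close>.

  The quotients are graded because the generators are homogeneous: a quotient by a homogeneous ideal
  inherits the grading (\<open>quot_graded_algebra\<close>), and homogeneous elements generate a homogeneous ideal
  (\<open>homogeneous_ideal_genideal\<close>).

  The components of a polynomial and the map \<open>e\<close> are obtained by the same operation, which
  discards all terms whose monomial fails a given condition: the degree is \<open>d\<close> in the first case, and
  only variables from \<open>L'\<close> occur in the second.
\<close>

section \<open>Quotients of graded algebras by homogeneous ideals\<close>

lemma (in abelian_monoid) finsum_support:
  assumes "finite D" "\<And>d. d \<notin> D \<Longrightarrow> f d = \<zero>" "\<And>d. f d \<in> carrier G"
  shows "(\<Oplus>d\<in>{d. f d \<noteq> \<zero>}. f d) = (\<Oplus>d\<in>D. f d)"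
  by (rule add.finprod_mono_neutral_cong) (use assms in \<open>auto intro: finite_subset\<close>)

lemma (in graded_algebra) hpart_carrier: "x \<in> hpart R d \<Longrightarrow> x \<in> carrier R"
  using submoduleE(1)[OF hpart_submodule[of d]] by blast

lemma (in graded_algebra) hpart_zero: "\<zero>\<^bsub>R\<^esub> \<in> hpart R d"
  using hpart_submodule[of d] by (simp add: submodule_def subgroup_def)

lemma (in graded_algebra) obtain_components:
  assumes "x \<in> carrier R"
  obtains f where "\<And>d. f d \<in> hpart R d" "finite {d. f d \<noteq> \<zero>\<^bsub>R\<^esub>}"
    "x = (\<Oplus>\<^bsub>R\<^esub>d\<in>{d. f d \<noteq> \<zero>\<^bsub>R\<^esub>}. f d)"
proof -
  obtain f where "(\<forall>d. f d \<in> hpart R d) \<and> finite {d. f d \<noteq> \<zero>\<^bsub>R\<^esub>} \<and>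
      x = (\<Oplus>\<^bsub>R\<^esub>d\<in>{d. f d \<noteq> \<zero>\<^bsub>R\<^esub>}. f d)"
    using hpart_direct_sum[OF assms] by (elim ex1E)
  with that[of f] show thesis
    by simp
qed

text \<open>
  Summing over a common finite index set rather than over the supports makes it possible to compare
  families with different supports, and to add families, where cancellation may shrink the support.
\<close>
lemma (in graded_algebra) components_unique:
  assumes "finite D"
    and f: "\<And>d. f d \<in> hpart R d" "\<And>d. d \<notin> D \<Longrightarrow> f d = \<zero>\<^bsub>R\<^esub>"
    and g: "\<And>d. g d \<in> hpart R d" "\<And>d. d \<notin> D \<Longrightarrow> g d = \<zero>\<^bsub>R\<^esub>"
    and eq: "(\<Oplus>\<^bsub>R\<^esub>d\<in>D. f d) = (\<Oplus>\<^bsub>R\<^esub>d\<in>D. g d)"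
  shows "f = g"
proof -
  have carr: "\<And>d. f d \<in> carrier R" "\<And>d. g d \<in> carrier R"
    using f(1) g(1) hpart_carrier by blast+
  have "finite {d. f d \<noteq> \<zero>\<^bsub>R\<^esub>}" "finite {d. g d \<noteq> \<zero>\<^bsub>R\<^esub>}"
    using f(2) g(2) by (auto intro: finite_subset[OF _ \<open>finite D\<close>])
  moreover have "(\<Oplus>\<^bsub>R\<^esub>d\<in>D. f d) \<in> carrier R"
    using carr by (intro finsum_closed) auto
  moreover have "(\<Oplus>\<^bsub>R\<^esub>d\<in>D. f d) = (\<Oplus>\<^bsub>R\<^esub>d\<in>{d. f d \<noteq> \<zero>\<^bsub>R\<^esub>}. f d)"
    "(\<Oplus>\<^bsub>R\<^esub>d\<in>D. f d) = (\<Oplus>\<^bsub>R\<^esub>d\<in>{d. g d \<noteq> \<zero>\<^bsub>R\<^esub>}. g d)"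
    using finsum_support[OF \<open>finite D\<close> f(2) carr(1)] finsum_support[OF \<open>finite D\<close> g(2) carr(2)] eq
    by simp_all
  ultimately show ?thesis
    using hpart_direct_sum[of "\<Oplus>\<^bsub>R\<^esub>d\<in>D. f d"] f(1) g(1) by blast
qed

definition homogeneous_ideal :: "'b set \<Rightarrow> ('k, 'b, 'n) graded_alg_scheme \<Rightarrow> bool" where
  "homogeneous_ideal I S \<longleftrightarrow> ideal I S \<and>
    (\<forall>x\<in>I. \<exists>f. (\<forall>d. f d \<in> hpart S d \<inter> I) \<and> finite {d. f d \<noteq> \<zero>\<^bsub>S\<^esub>} \<and>
      x = (\<Oplus>\<^bsub>S\<^esub>d\<in>{d. f d \<noteq> \<zero>\<^bsub>S\<^esub>}. f d))"

locale graded_algebra_with_ideal = graded_algebra K S + ideal I S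
  for K :: "('k, 'm) ring_scheme" and S :: "('k, 'b, 'n) graded_alg_scheme" (structure) and I
begin

lemma coset_eq_iff:
  assumes "x \<in> carrier S" "y \<in> carrier S"
  shows "I +> x = I +> y \<longleftrightarrow> x \<ominus> y \<in> I"
  using quotient_eq_iff_same_a_r_cos[OF is_ideal assms] by simp

lemma quot_carrier: "carrier (quot_graded_alg S I) = (\<lambda>x. I +> x) ` carrier S"
  by (auto simp: quot_graded_alg_def FactRing_simps)

lemma quot_zero: "\<zero>\<^bsub>quot_graded_alg S I\<^esub> = I +> \<zero>"
  by (simp add: quot_graded_alg_def FactRing_def a_rcos_const)

lemma quot_one: "\<one>\<^bsub>quot_graded_alg S I\<^esub> = I +> \<one>"
  by (simp add: quot_graded_alg_def FactRing_def)

lemma quot_add: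
  "\<lbrakk>x \<in> carrier S; y \<in> carrier S\<rbrakk> \<Longrightarrow> (I +> x) \<oplus>\<^bsub>quot_graded_alg S I\<^esub> (I +> y) = I +> (x \<oplus> y)"
  by (simp add: quot_graded_alg_def FactRing_def a_rcos_sum)

lemma quot_mult:
  "\<lbrakk>x \<in> carrier S; y \<in> carrier S\<rbrakk> \<Longrightarrow> (I +> x) \<otimes>\<^bsub>quot_graded_alg S I\<^esub> (I +> y) = I +> (x \<otimes> y)"
  by (simp add: quot_graded_alg_def FactRing_def rcoset_mult_add)

lemma quot_hpart: "hpart (quot_graded_alg S I) d = (\<lambda>x. I +> x) ` hpart S d"
  by (simp add: quot_graded_alg_def)

text \<open>
  An ideal is closed under scalars because \<open>c \<odot> x = (c \<odot> \<one>) \<otimes> x\<close>; this makes the scalar action on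
  cosets independent of the representative.
\<close>
lemma ideal_smult_closed:
  assumes "c \<in> carrier K" "x \<in> I"
  shows "c \<odot> x \<in> I"
proof -
  have "c \<odot> x = (c \<odot> \<one>) \<otimes> x"
    using assms a_Hcarr by (simp add: smult_assoc2)
  then show ?thesis
    using assms by (simp add: I_l_closed)
qed

lemma quot_smult:
  assumes "c \<in> carrier K" "x \<in> carrier S"
  shows "c \<odot>\<^bsub>quot_graded_alg S I\<^esub> (I +> x) = I +> (c \<odot> x)"
proof -
  have "I +> (c \<odot> y) = I +> (c \<odot> x)" if y: "y \<in> I +> x" for y
  proof -
    obtain h where h: "h \<in> I" "y = h \<oplus> x"
      using y by (auto simp: a_r_coset_def r_coset_def)
    have "c \<odot> y = (c \<odot> h) \<oplus> (c \<odot> x)"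
      using h assms a_Hcarr by (simp add: smult_r_distr)
    moreover have "c \<odot> h \<in> I"
      using h assms ideal_smult_closed by simp
    ultimately show ?thesis
      using assms a_Hcarr by (metis a_rcos_const a_coset_add_assoc a_subset smult_closed)
  qed
  moreover have "x \<in> I +> x"
    using assms a_rcos_self by simp
  ultimately have "(\<Union>y\<in>I +> x. I +> (c \<odot> y)) = I +> (c \<odot> x)"
    by blast
  then show ?thesis
    by (simp add: quot_graded_alg_def)
qed

lemmas quot_simps = quot_zero quot_one quot_add quot_mult quot_smult

lemma quot_cring: "cring (quot_graded_alg S I)"
proof (rule cringI)
  show "abelian_group (quot_graded_alg S I)"
  proof (rule abelian_groupI, goal_cases)
    case (6 C)
    then obtain x where "x \<in> carrier S" "C = I +> x"
      by (auto simp: quot_carrier)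
    then show ?case
      by (auto simp: quot_carrier quot_simps l_neg intro!: bexI[of _ "\<ominus> x"])
  qed (auto simp: quot_carrier quot_simps a_assoc a_comm a_lcomm)
  show "comm_monoid (quot_graded_alg S I)"
    by (rule comm_monoidI) (auto simp: quot_carrier quot_simps m_assoc m_comm m_lcomm)
qed (auto simp: quot_carrier quot_simps l_distr)

lemma quot_algebra: "algebra K (quot_graded_alg S I)"
  by (rule algebraI)
    (auto simp: quot_carrier quot_simps quot_cring R_cring smult_l_distr smult_r_distr
      smult_assoc1 smult_assoc2)

lemma quot_hom: "ring_hom_cring S (quot_graded_alg S I) (\<lambda>x. I +> x)"
  by (intro ring_hom_cring.intro ring_hom_cring_axioms.intro ring_hom_memI quot_cring M_cring)
    (auto simp: quot_carrier quot_simps)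

text \<open>
  The component \<open>\<zero>\<close> is lifted to \<open>\<zero>\<close> and not to an arbitrary element of \<open>I\<close>; otherwise the lifted
  family could have infinite support.
\<close>
lemma lift_components:
  assumes "\<And>d. g d \<in> hpart (quot_graded_alg S I) d"
    and "finite D" "\<And>d. d \<notin> D \<Longrightarrow> g d = \<zero>\<^bsub>quot_graded_alg S I\<^esub>"
  obtains p where "\<And>d. p d \<in> hpart S d" "\<And>d. g d = I +> p d" "\<And>d. d \<notin> D \<Longrightarrow> p d = \<zero>"
    "(\<Oplus>\<^bsub>quot_graded_alg S I\<^esub>d\<in>D. g d) = I +> (\<Oplus>d\<in>D. p d)"
proof -
  interpret Q: ring_hom_cring S "quot_graded_alg S I" "\<lambda>x. I +> x"
    by (rule quot_hom)
  have "\<exists>x. x \<in> hpart S d \<and> g d = I +> x \<and> (d \<notin> D \<longrightarrow> x = \<zero>)" for d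
  proof (cases "d \<in> D")
    case True
    obtain x where "x \<in> hpart S d" "g d = I +> x"
      using assms(1)[of d] unfolding quot_hpart by blast
    with True show ?thesis
      by blast
  next
    case False
    with hpart_zero[of d] show ?thesis
      using assms(3)[of d] unfolding quot_zero by blast
  qed
  then obtain p where p: "\<And>d. p d \<in> hpart S d" "\<And>d. g d = I +> p d"
      "\<And>d. d \<notin> D \<Longrightarrow> p d = \<zero>"
    by metis
  have "g = (\<lambda>d. I +> p d)"
    using p(2) by (rule ext)
  then have "(\<Oplus>\<^bsub>quot_graded_alg S I\<^esub>d\<in>D. g d) = I +> (\<Oplus>d\<in>D. p d)"
    using p(1) hpart_carrier by (subst Q.hom_finsum) (auto simp: comp_def)
  with p show thesis
    by (rule that)
qed

text \<open>
  Components of a coset exist because one may take the cosets of the components of a representative.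
  They are unique because two decompositions lift to elements of \<open>S\<close> whose difference lies in \<open>I\<close>;
  since \<open>I\<close> is homogeneous, the components of that difference lie in \<open>I\<close> one by one.
\<close>
theorem quot_graded_algebra:
  assumes "homogeneous_ideal I S"
  shows "graded_algebra K (quot_graded_alg S I)"
proof -
  let ?Q = "quot_graded_alg S I"
  interpret Q: algebra K ?Q
    by (rule quot_algebra)
  interpret \<pi>: ring_hom_cring S ?Q "\<lambda>x. I +> x"
    by (rule quot_hom)
  have Qcarr: "x \<in> hpart ?Q d \<Longrightarrow> x \<in> carrier ?Q" for x d
    using hpart_carrier by (auto simp: quot_hpart quot_carrier)
  show ?thesis
  proof (intro graded_algebra.intro graded_algebra_axioms.intro)
    show "algebra K ?Q"
      by (rule quot_algebra)
    show "submodule (hpart ?Q d) K ?Q" for d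
    proof (rule Q.submoduleI)
      note sub = submoduleE[OF hpart_submodule[of d]]
      show "hpart ?Q d \<subseteq> carrier ?Q"
        using Qcarr by blast
      show "\<zero>\<^bsub>?Q\<^esub> \<in> hpart ?Q d"
        unfolding quot_hpart quot_zero using hpart_zero by blast
      show "\<ominus>\<^bsub>?Q\<^esub> a \<in> hpart ?Q d" if a: "a \<in> hpart ?Q d" for a
      proof -
        obtain x where x: "x \<in> hpart S d" "a = I +> x"
          using a unfolding quot_hpart by blast
        then have "\<ominus>\<^bsub>?Q\<^esub> a = I +> (\<ominus> x)"
          using hpart_carrier by simp
        then show ?thesis
          unfolding quot_hpart using sub(3)[OF x(1)] by blast
      qed
      show "a \<oplus>\<^bsub>?Q\<^esub> b \<in> hpart ?Q d" if ab: "a \<in> hpart ?Q d" "b \<in> hpart ?Q d" for a b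
      proof -
        obtain x y where xy: "x \<in> hpart S d" "a = I +> x" "y \<in> hpart S d" "b = I +> y"
          using ab unfolding quot_hpart by blast
        then have "a \<oplus>\<^bsub>?Q\<^esub> b = I +> (x \<oplus> y)"
          using hpart_carrier by simp
        then show ?thesis
          unfolding quot_hpart using sub(5)[OF xy(1,3)] by blast
      qed
      show "c \<odot>\<^bsub>?Q\<^esub> a \<in> hpart ?Q d" if c: "c \<in> carrier K" and a: "a \<in> hpart ?Q d" for c a
      proof -
        obtain x where x: "x \<in> hpart S d" "a = I +> x"
          using a unfolding quot_hpart by blast
        then have "c \<odot>\<^bsub>?Q\<^esub> a = I +> (c \<odot> x)"
          using c hpart_carrier by (simp add: quot_smult)
        then show ?thesis
          unfolding quot_hpart using sub(4)[OF c x(1)] by blast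
      qed
    qed
    show "a \<otimes>\<^bsub>?Q\<^esub> b \<in> hpart ?Q (d + e)" if ab: "a \<in> hpart ?Q d" "b \<in> hpart ?Q e" for a b d e
    proof -
      obtain x y where xy: "x \<in> hpart S d" "a = I +> x" "y \<in> hpart S e" "b = I +> y"
        using ab unfolding quot_hpart by blast
      then have "a \<otimes>\<^bsub>?Q\<^esub> b = I +> (x \<otimes> y)"
        using hpart_carrier by simp
      then show ?thesis
        unfolding quot_hpart using hpart_mult[OF xy(1,3)] by blast
    qed
    show "\<exists>!f. (\<forall>d. f d \<in> hpart ?Q d) \<and> finite {d. f d \<noteq> \<zero>\<^bsub>?Q\<^esub>} \<and>
        C = (\<Oplus>\<^bsub>?Q\<^esub>d\<in>{d. f d \<noteq> \<zero>\<^bsub>?Q\<^esub>}. f d)" if C: "C \<in> carrier ?Q" for C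
    proof (rule ex_ex1I)
      obtain x where x: "x \<in> carrier S" "C = I +> x"
        using C unfolding quot_carrier by blast
      obtain f where f: "\<And>d. f d \<in> hpart S d" "finite {d. f d \<noteq> \<zero>}"
          "x = (\<Oplus>d\<in>{d. f d \<noteq> \<zero>}. f d)"
        using obtain_components[OF x(1)] by blast
      let ?g = "\<lambda>d. I +> f d"
      have carr: "f d \<in> carrier S" for d
        using f(1) hpart_carrier by blast
      have "C = (\<Oplus>\<^bsub>?Q\<^esub>d\<in>{d. f d \<noteq> \<zero>}. ?g d)"
        unfolding x(2) f(3)[symmetric] \<pi>.hom_finsum[OF funcsetI[OF carr], unfolded comp_def, symmetric] ..
      also have "\<dots> = (\<Oplus>\<^bsub>?Q\<^esub>d\<in>{d. ?g d \<noteq> \<zero>\<^bsub>?Q\<^esub>}. ?g d)"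
        by (rule Q.finsum_support[OF f(2), symmetric]) (use carr in simp_all)
      finally have "C = \<dots>" .
      moreover have "finite {d. ?g d \<noteq> \<zero>\<^bsub>?Q\<^esub>}"
        by (rule finite_subset[OF Collect_mono f(2)]) (metis \<pi>.hom_zero)
      moreover have "?g d \<in> hpart ?Q d" for d
        using f(1) unfolding quot_hpart by blast
      ultimately show "\<exists>g. (\<forall>d. g d \<in> hpart ?Q d) \<and> finite {d. g d \<noteq> \<zero>\<^bsub>?Q\<^esub>} \<and>
          C = (\<Oplus>\<^bsub>?Q\<^esub>d\<in>{d. g d \<noteq> \<zero>\<^bsub>?Q\<^esub>}. g d)"
        by (intro exI[of _ ?g]) simp
    next
      fix g h
      assume "(\<forall>d. g d \<in> hpart ?Q d) \<and> finite {d. g d \<noteq> \<zero>\<^bsub>?Q\<^esub>} \<and>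
          C = (\<Oplus>\<^bsub>?Q\<^esub>d\<in>{d. g d \<noteq> \<zero>\<^bsub>?Q\<^esub>}. g d)"
      then have g: "\<And>d. g d \<in> hpart ?Q d" "finite {d. g d \<noteq> \<zero>\<^bsub>?Q\<^esub>}"
          "C = (\<Oplus>\<^bsub>?Q\<^esub>d\<in>{d. g d \<noteq> \<zero>\<^bsub>?Q\<^esub>}. g d)"
        by auto
      assume "(\<forall>d. h d \<in> hpart ?Q d) \<and> finite {d. h d \<noteq> \<zero>\<^bsub>?Q\<^esub>} \<and>
          C = (\<Oplus>\<^bsub>?Q\<^esub>d\<in>{d. h d \<noteq> \<zero>\<^bsub>?Q\<^esub>}. h d)"
      then have h: "\<And>d. h d \<in> hpart ?Q d" "finite {d. h d \<noteq> \<zero>\<^bsub>?Q\<^esub>}"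
          "C = (\<Oplus>\<^bsub>?Q\<^esub>d\<in>{d. h d \<noteq> \<zero>\<^bsub>?Q\<^esub>}. h d)"
        by auto
      define D where "D = {d. g d \<noteq> \<zero>\<^bsub>?Q\<^esub>} \<union> {d. h d \<noteq> \<zero>\<^bsub>?Q\<^esub>}"
      have D: "finite D" "\<And>d. d \<notin> D \<Longrightarrow> g d = \<zero>\<^bsub>?Q\<^esub>" "\<And>d. d \<notin> D \<Longrightarrow> h d = \<zero>\<^bsub>?Q\<^esub>"
        using g(2) h(2) by (auto simp: D_def)
      obtain p where p: "\<And>d. p d \<in> hpart S d" "\<And>d. g d = I +> p d" "\<And>d. d \<notin> D \<Longrightarrow> p d = \<zero>"
          "(\<Oplus>\<^bsub>?Q\<^esub>d\<in>D. g d) = I +> (\<Oplus>d\<in>D. p d)"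
        using lift_components[of g, OF g(1) D(1,2)] by blast
      obtain q where q: "\<And>d. q d \<in> hpart S d" "\<And>d. h d = I +> q d" "\<And>d. d \<notin> D \<Longrightarrow> q d = \<zero>"
          "(\<Oplus>\<^bsub>?Q\<^esub>d\<in>D. h d) = I +> (\<Oplus>d\<in>D. q d)"
        using lift_components[of h, OF h(1) D(1,3)] by blast
      have carr: "p d \<in> carrier S" "q d \<in> carrier S" for d
        using p(1) q(1) hpart_carrier by blast+
      let ?x = "\<Oplus>d\<in>D. p d" and ?y = "\<Oplus>d\<in>D. q d"
      have xy: "?x \<in> carrier S" "?y \<in> carrier S"
        using carr by auto
      have "C = (\<Oplus>\<^bsub>?Q\<^esub>d\<in>D. g d)" "C = (\<Oplus>\<^bsub>?Q\<^esub>d\<in>D. h d)"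
        using g(3) h(3) Q.finsum_support[OF D(1), of g] Q.finsum_support[OF D(1), of h]
          D(2,3) Qcarr[OF g(1)] Qcarr[OF h(1)] by simp_all
      then have "I +> ?x = I +> ?y"
        unfolding p(4) q(4) by (rule subst)
      then have "?x \<ominus> ?y \<in> I"
        using coset_eq_iff[OF xy] by blast
      then obtain f where f: "\<And>d. f d \<in> hpart S d" "\<And>d. f d \<in> I" "finite {d. f d \<noteq> \<zero>}"
          "?x \<ominus> ?y = (\<Oplus>d\<in>{d. f d \<noteq> \<zero>}. f d)"
        using assms unfolding homogeneous_ideal_def by (metis Int_iff)
      have fcarr: "f d \<in> carrier S" for d
        using f(1) hpart_carrier by blast
      \<comment> \<open>That \<open>f\<close> vanishes outside \<open>D\<close> is a consequence of uniqueness, so the index set must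
        provide for its support as well.\<close>
      define E where "E = D \<union> {d. f d \<noteq> \<zero>}"
      have E: "finite E" "\<And>d. d \<notin> E \<Longrightarrow> p d = \<zero>" "\<And>d. d \<notin> E \<Longrightarrow> q d = \<zero>" "\<And>d. d \<notin> E \<Longrightarrow> f d = \<zero>"
        using D(1) f(3) p(3) q(3) by (auto simp: E_def)
      have sum_p: "?x = (\<Oplus>d\<in>E. p d)"
        by (rule trans[OF finsum_support[of D p, symmetric] finsum_support[of E p]])
          (use D(1) E p(3) carr in blast)+
      have sum_q: "?y = (\<Oplus>d\<in>E. q d)"
        by (rule trans[OF finsum_support[of D q, symmetric] finsum_support[of E q]])
          (use D(1) E q(3) carr in blast)+
      have sum_f: "?x \<ominus> ?y = (\<Oplus>d\<in>E. f d)"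
        unfolding f(4) by (rule finsum_support[of E f]) (use E fcarr in blast)+
      have "(\<Oplus>d\<in>E. p d) = ?y \<oplus> (?x \<ominus> ?y)"
        unfolding sum_p[symmetric] using xy by algebra
      also have "\<dots> = (\<Oplus>d\<in>E. q d \<oplus> f d)"
        unfolding sum_f unfolding sum_q by (rule finsum_addf[symmetric]) (use carr fcarr in blast)+
      finally have sum_eq: "(\<Oplus>d\<in>E. p d) = (\<Oplus>d\<in>E. q d \<oplus> f d)" .
      have "p = (\<lambda>d. q d \<oplus> f d)"
        using sum_eq p(1) q(1) f(1) E submoduleE(5)[OF hpart_submodule]
        by (intro components_unique[OF E(1)]) auto
      moreover have "q d \<oplus> f d \<ominus> q d = f d" for d
        using carr[of d] fcarr[of d] by algebra
      ultimately have "p d \<ominus> q d \<in> I" for d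
        using f(2)[of d] by simp
      then have "I +> p d = I +> q d" for d
        using coset_eq_iff[OF carr] by blast
      then show "g = h"
        using p(2) q(2) by auto
    qed
  qed
qed

end

section \<open>Homomorphisms and retracts of quotients\<close>

lemma graded_algebra_hom_quot:
  assumes "graded_algebra_with_ideal K S I" "graded_algebra_with_ideal K T J"
    and h: "h \<in> graded_algebra_hom K S T" and IJ: "h ` I \<subseteq> J"
  shows "\<exists>h' \<in> graded_algebra_hom K (quot_graded_alg S I) (quot_graded_alg T J).
    \<forall>x\<in>carrier S. h' (I +>\<^bsub>S\<^esub> x) = J +>\<^bsub>T\<^esub> h x"
proof -
  interpret S: graded_algebra_with_ideal K S I by fact
  interpret T: graded_algebra_with_ideal K T J by fact
  interpret h: ring_hom_cring S T h
    using h by (intro ring_hom_cring.intro ring_hom_cring_axioms.intro S.M_cring T.M_cring) (simp add: graded_algebra_hom_def)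
  have smult: "h (c \<odot>\<^bsub>S\<^esub> x) = c \<odot>\<^bsub>T\<^esub> h x" if "c \<in> carrier K" "x \<in> carrier S" for c x
    using h that by (simp add: graded_algebra_hom_def)
  have hpart: "h x \<in> hpart T d" if "x \<in> hpart S d" for x d
    using h that unfolding graded_algebra_hom_def by blast
  define h' where "h' C = J +>\<^bsub>T\<^esub> h (SOME x. x \<in> carrier S \<and> C = I +>\<^bsub>S\<^esub> x)" for C
  have h'_coset: "h' (I +>\<^bsub>S\<^esub> x) = J +>\<^bsub>T\<^esub> h x" if x: "x \<in> carrier S" for x
  proof -
    let ?y = "SOME y. y \<in> carrier S \<and> I +>\<^bsub>S\<^esub> x = I +>\<^bsub>S\<^esub> y"
    have y: "?y \<in> carrier S \<and> I +>\<^bsub>S\<^esub> x = I +>\<^bsub>S\<^esub> ?y"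
      by (rule someI[of _ x]) (simp add: x)
    then have "?y \<ominus>\<^bsub>S\<^esub> x \<in> I"
      using S.coset_eq_iff[of ?y x] x by simp
    then have "h (?y \<ominus>\<^bsub>S\<^esub> x) \<in> J"
      using IJ by blast
    then have "h ?y \<ominus>\<^bsub>T\<^esub> h x \<in> J"
      using x y by (simp add: S.minus_eq T.minus_eq)
    then show ?thesis
      using x y T.coset_eq_iff by (simp add: h'_def)
  qed
  have "h' \<in> graded_algebra_hom K (quot_graded_alg S I) (quot_graded_alg T J)"
    unfolding graded_algebra_hom_def
    by (auto intro!: ring_hom_memI simp: S.quot_carrier T.quot_carrier S.quot_simps T.quot_simps
        S.quot_hpart T.quot_hpart h'_coset smult S.hpart_carrier hpart)
  then show ?thesis
    using h'_coset by blast
qed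

text \<open>
  The composite of the two induced maps fixes every coset because \<open>e \<circ> i\<close> fixes every
  representative; hence the first is injective and the second surjective.
\<close>
theorem algebra_retract_quot:
  assumes S: "graded_algebra K S" and T: "graded_algebra K T"
    and I: "homogeneous_ideal I S" and J: "homogeneous_ideal J T"
    and i: "i \<in> graded_algebra_hom K S T" and e: "e \<in> graded_algebra_hom K T S"
    and ei: "\<And>x. x \<in> carrier S \<Longrightarrow> e (i x) = x"
    and IJ: "i ` I \<subseteq> J" and JI: "e ` J \<subseteq> I"
  shows "\<exists>\<iota>. (\<forall>x\<in>carrier S. \<iota> (I +>\<^bsub>S\<^esub> x) = J +>\<^bsub>T\<^esub> i x) \<and>
    algebra_retract K \<iota> (quot_graded_alg S I) (quot_graded_alg T J)"
proof -
  interpret S: graded_algebra_with_ideal K S I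
    using S I by (simp add: graded_algebra_with_ideal_def homogeneous_ideal_def)
  interpret T: graded_algebra_with_ideal K T J
    using T J by (simp add: graded_algebra_with_ideal_def homogeneous_ideal_def)
  obtain \<iota> where \<iota>: "\<iota> \<in> graded_algebra_hom K (quot_graded_alg S I) (quot_graded_alg T J)"
      "\<And>x. x \<in> carrier S \<Longrightarrow> \<iota> (I +>\<^bsub>S\<^esub> x) = J +>\<^bsub>T\<^esub> i x"
    using graded_algebra_hom_quot[OF S.graded_algebra_with_ideal_axioms
        T.graded_algebra_with_ideal_axioms i IJ] by blast
  obtain \<epsilon> where \<epsilon>: "\<epsilon> \<in> graded_algebra_hom K (quot_graded_alg T J) (quot_graded_alg S I)"
      "\<And>x. x \<in> carrier T \<Longrightarrow> \<epsilon> (J +>\<^bsub>T\<^esub> x) = I +>\<^bsub>S\<^esub> e x"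
    using graded_algebra_hom_quot[OF T.graded_algebra_with_ideal_axioms
        S.graded_algebra_with_ideal_axioms e JI] by blast
  have i_carr: "i x \<in> carrier T" if "x \<in> carrier S" for x
    using i that by (auto simp: graded_algebra_hom_def ring_hom_closed)
  have id: "\<epsilon> (\<iota> C) = C" if "C \<in> carrier (quot_graded_alg S I)" for C
    using that by (auto simp: S.quot_carrier \<iota> \<epsilon> ei i_carr)
  have "inj_on \<iota> (carrier (quot_graded_alg S I))"
    using id by (rule inj_on_inverseI)
  moreover have "\<epsilon> ` carrier (quot_graded_alg T J) = carrier (quot_graded_alg S I)"
  proof -
    have "\<iota> \<in> carrier (quot_graded_alg S I) \<rightarrow> carrier (quot_graded_alg T J)"
      "\<epsilon> \<in> carrier (quot_graded_alg T J) \<rightarrow> carrier (quot_graded_alg S I)"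
      using \<iota>(1) \<epsilon>(1) by (simp_all add: graded_algebra_hom_def ring_hom_def)
    then show ?thesis
      using id by (intro equalityI subsetI) (blast, metis funcset_mem imageI)
  qed
  ultimately show ?thesis
    unfolding algebra_retract_def
    using \<iota> \<epsilon>(1) id S.quot_graded_algebra[OF I] T.quot_graded_algebra[OF J]
    by (intro exI[of _ \<iota>] conjI bexI[of _ \<epsilon>] ballI) simp_all
qed

text \<open>The preimage of an ideal is an ideal, so generators suffice.\<close>
lemma (in ring_hom_ring) image_genideal_subset:
  assumes "ideal J S" "G \<subseteq> carrier R" "h ` G \<subseteq> J"
  shows "h ` genideal R G \<subseteq> J"
proof -
  have "genideal R G \<subseteq> {r \<in> carrier R. h r \<in> J}"
    using assms by (intro R.genideal_minimal ideal_vimage) auto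
  then show ?thesis
    by auto
qed

section \<open>Parts of a polynomial cut out by a set of monomials\<close>

lift_definition mono_part :: "('m \<Rightarrow> bool) \<Rightarrow> ('m \<Rightarrow>\<^sub>0 'k::zero) \<Rightarrow> ('m \<Rightarrow>\<^sub>0 'k)"
  is "\<lambda>P f m. f m when P m"
  by (rule finite_subset[rotated]) auto

lemma mono_part_zero [simp]: "mono_part P 0 = 0"
  by transfer simp

lemma mono_part_add: "mono_part P (p + q) = mono_part P p + mono_part P (q :: _ \<Rightarrow>\<^sub>0 _ :: monoid_add)"
  by transfer (auto simp: when_def)

lemma mono_part_uminus: "mono_part P (- p) = - mono_part P (p :: _ \<Rightarrow>\<^sub>0 _ :: ab_group_add)"
  by transfer (auto simp: when_def)

lemma mono_part_single [simp]: "mono_part P (Poly_Mapping.single m c) = (Poly_Mapping.single m c when P m)"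
  by (rule poly_mapping_eqI) (auto simp: mono_part.rep_eq lookup_single when_def)

lemma keys_mono_part: "Poly_Mapping.keys (mono_part P p) = {m \<in> Poly_Mapping.keys p. P m}"
  by (auto simp: in_keys_iff mono_part.rep_eq when_def split: if_splits)

lemma mono_part_all: "(\<And>m. m \<in> Poly_Mapping.keys p \<Longrightarrow> P m) \<Longrightarrow> mono_part P p = p"
  by (rule poly_mapping_eqI) (auto simp: mono_part.rep_eq when_def in_keys_iff)

lemma mono_part_none: "(\<And>m. m \<in> Poly_Mapping.keys p \<Longrightarrow> \<not> P m) \<Longrightarrow> mono_part P p = 0"
  by (rule poly_mapping_eqI) (auto simp: mono_part.rep_eq when_def in_keys_iff)

lemma poly_mapping_eq_sum_single:
  "p = (\<Sum>m\<in>Poly_Mapping.keys p. Poly_Mapping.single m (Poly_Mapping.lookup p m))"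
  by (rule poly_mapping_eqI)
    (auto simp: lookup_sum lookup_single when_def in_keys_iff if_distrib cong: if_cong)

lemma poly_mapping_additive_induct [case_names zero single add]:
  fixes p :: "'m \<Rightarrow>\<^sub>0 'k::comm_monoid_add"
  assumes "Q 0"
    and "\<And>m c. m \<in> Poly_Mapping.keys p \<Longrightarrow> Q (Poly_Mapping.single m c)"
    and "\<And>f g. Q f \<Longrightarrow> Q g \<Longrightarrow> Q (f + g)"
  shows "Q p"
proof -
  have "Q (\<Sum>m\<in>M. Poly_Mapping.single m (Poly_Mapping.lookup p m))"
    if "finite M" "M \<subseteq> Poly_Mapping.keys p" for M
    using that assms by (induction M) auto
  from this[OF finite_keys subset_refl] show ?thesis
    by (simp flip: poly_mapping_eq_sum_single)
qed

text \<open>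
  A term of \<open>p\<close> at \<open>n\<close> contributes to the product at \<open>m + n\<close>, so the condition is pulled back along
  \<open>n \<mapsto> m + n\<close>.
\<close>
lemma mono_part_single_mult:
  fixes p :: "'m::comm_monoid_add \<Rightarrow>\<^sub>0 'k::comm_semiring_0"
  shows "mono_part P (Poly_Mapping.single m c * p) =
    Poly_Mapping.single m c * mono_part (\<lambda>n. P (m + n)) p"
  by (induction p rule: poly_mapping_additive_induct)
    (auto simp: mono_part_add distrib_left mult_single when_def)

text \<open>
  Cutting down to a set of monomials that contains a product exactly if it contains both factors is
  multiplicative: products of kept monomials are kept, and the discarded monomials span an ideal.
\<close>
lemma mono_part_mult:
  fixes p q :: "'m::comm_monoid_add \<Rightarrow>\<^sub>0 'k::comm_semiring_0"
  assumes "\<And>m n. P (m + n) \<longleftrightarrow> P m \<and> P n"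
  shows "mono_part P (p * q) = mono_part P p * mono_part P q"
proof (induction p rule: poly_mapping_additive_induct)
  case (single m c)
  show ?case
    by (cases "P m") (auto simp: mono_part_single_mult assms mono_part_none)
qed (auto simp: mono_part_add distrib_right)

section \<open>The polynomial ring as a graded algebra\<close>

abbreviation involves_only :: "'a set \<Rightarrow> ('a \<Rightarrow>\<^sub>0 nat) \<Rightarrow> bool" where
  "involves_only A m \<equiv> Poly_Mapping.keys m \<subseteq> A"

abbreviation hcomponent :: "nat \<Rightarrow> ('a, 'k::zero) mpoly \<Rightarrow> ('a, 'k) mpoly" where
  "hcomponent d \<equiv> mono_part (\<lambda>m. mono_degree m = d)"

lemma poly_alg_carrier:
  "p \<in> carrier (poly_alg A) \<longleftrightarrow> (\<forall>m\<in>Poly_Mapping.keys p. involves_only A m)"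
  by (simp add: poly_alg_def)

lemma poly_alg_hpart:
  "p \<in> hpart (poly_alg A) d \<longleftrightarrow>
    p \<in> carrier (poly_alg A) \<and> (\<forall>m\<in>Poly_Mapping.keys p. mono_degree m = d)"
  by (auto simp: poly_alg_def)

lemma poly_alg_simps [simp]:
  "\<zero>\<^bsub>poly_alg A\<^esub> = 0" "\<one>\<^bsub>poly_alg A\<^esub> = 1"
  "p \<oplus>\<^bsub>poly_alg A\<^esub> q = p + q" "p \<otimes>\<^bsub>poly_alg A\<^esub> q = p * q"
  "c \<odot>\<^bsub>poly_alg A\<^esub> p = Poly_Mapping.single 0 c * p"
  by (simp_all add: poly_alg_def)

lemma keys_plus_nat:
  "Poly_Mapping.keys (m + n) = Poly_Mapping.keys m \<union> Poly_Mapping.keys (n :: 'a \<Rightarrow>\<^sub>0 nat)"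
  by (auto simp: in_keys_iff lookup_add)

lemma mono_degree_plus: "mono_degree (m + n) = mono_degree m + mono_degree n"
  unfolding mono_degree_def by (rule setsum_keys_plus_distrib) auto

lemma mono_degree_zero [simp]: "mono_degree 0 = 0"
  by (simp add: mono_degree_def)

lemma keys_add_cases:
  "m \<in> Poly_Mapping.keys (p + q) \<Longrightarrow> m \<in> Poly_Mapping.keys p \<or> m \<in> Poly_Mapping.keys q"
  using keys_add[of p q] by blast

lemma keys_mult_cases:
  assumes "k \<in> Poly_Mapping.keys (p * q)"
  obtains m n where "m \<in> Poly_Mapping.keys p" "n \<in> Poly_Mapping.keys q" "k = m + n"
  using keys_mult[of p q] assms by blast

lemma poly_alg_closed:
  "0 \<in> carrier (poly_alg A)"
  "1 \<in> carrier (poly_alg A)"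
  "Poly_Mapping.single 0 c \<in> carrier (poly_alg A)"
  "p \<in> carrier (poly_alg A) \<Longrightarrow> q \<in> carrier (poly_alg A) \<Longrightarrow> p + q \<in> carrier (poly_alg A)"
  "p \<in> carrier (poly_alg A) \<Longrightarrow> - p \<in> carrier (poly_alg A)"
  "p \<in> carrier (poly_alg A) \<Longrightarrow> q \<in> carrier (poly_alg A) \<Longrightarrow> p * q \<in> carrier (poly_alg A)"
  unfolding poly_alg_carrier
  by (auto dest!: keys_add_cases elim!: keys_mult_cases simp: keys_plus_nat split: if_splits)

lemma poly_alg_cring: "cring (poly_alg A)"
proof (rule cringI)
  show "abelian_group (poly_alg A)"
  proof (rule abelian_groupI)
    show "\<exists>q\<in>carrier (poly_alg A). q \<oplus>\<^bsub>poly_alg A\<^esub> p = \<zero>\<^bsub>poly_alg A\<^esub>"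
      if "p \<in> carrier (poly_alg A)" for p
      using that by (intro bexI[of _ "- p"]) (simp_all add: poly_alg_closed)
  qed (simp_all add: poly_alg_closed algebra_simps)
  show "comm_monoid (poly_alg A)"
    by (rule comm_monoidI) (simp_all add: poly_alg_closed algebra_simps)
qed (simp_all add: algebra_simps)

lemma poly_alg_uminus:
  assumes "p \<in> carrier (poly_alg A)"
  shows "\<ominus>\<^bsub>poly_alg A\<^esub> p = - p"
proof -
  interpret cring "poly_alg A"
    by (rule poly_alg_cring)
  show ?thesis
    by (rule minus_equality) (use assms in \<open>simp_all add: poly_alg_closed\<close>)
qed

lemma poly_alg_finsum:
  assumes "\<And>d. d \<in> D \<Longrightarrow> f d \<in> carrier (poly_alg A)"
  shows "(\<Oplus>\<^bsub>poly_alg A\<^esub>d\<in>D. f d) = (\<Sum>d\<in>D. f d)"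
proof -
  interpret cring "poly_alg A"
    by (rule poly_alg_cring)
  show ?thesis
    using assms by (induction D rule: infinite_finite_induct) (auto simp: Pi_def)
qed

lemma poly_alg_algebra: "algebra (ring_of_type_algebra :: 'k::field ring) (poly_alg A)"
  by (rule algebraI, rule cring_from_type_algebra, rule poly_alg_cring)
    (simp_all add: poly_alg_closed ring_of_type_algebra_def single_add mult_single
      algebra_simps flip: mult.assoc)

lemma poly_alg_hpart_diff:
  assumes "p \<in> hpart (poly_alg A) d" "q \<in> hpart (poly_alg A) d"
  shows "p - q \<in> hpart (poly_alg A) d"
  using assms unfolding diff_conv_add_uminus poly_alg_hpart
  by (auto simp: poly_alg_closed simp del: add_uminus_conv_diff dest!: keys_add_cases)

lemma hcomponent_in_hpart:
  "p \<in> carrier (poly_alg A) \<Longrightarrow> hcomponent d p \<in> hpart (poly_alg A) d"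
  by (auto simp: poly_alg_hpart poly_alg_carrier keys_mono_part)

lemma hcomponent_hpart:
  "p \<in> hpart (poly_alg A) e \<Longrightarrow> hcomponent d p = (p when e = d)"
  by (auto simp: poly_alg_hpart when_def intro: mono_part_all mono_part_none)

lemma mono_part_sum:
  "mono_part P (\<Sum>d\<in>D. f d) = (\<Sum>d\<in>D. mono_part P (f d :: _ \<Rightarrow>\<^sub>0 _ :: comm_monoid_add))"
  by (induction D rule: infinite_finite_induct) (simp_all add: mono_part_add)

lemma finite_hcomponents: "finite {d. hcomponent d p \<noteq> 0}"
  by (rule finite_subset[of _ "mono_degree ` Poly_Mapping.keys p"])
    (auto intro!: mono_part_none)

lemma sum_hcomponents:
  fixes p :: "('a, 'k::comm_monoid_add) mpoly"
  shows "(\<Sum>d\<in>{d. hcomponent d p \<noteq> 0}. hcomponent d p) = p"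
proof (rule poly_mapping_eqI)
  fix m
  let ?D = "{d. hcomponent d p \<noteq> 0}"
  have "Poly_Mapping.lookup (\<Sum>d\<in>?D. hcomponent d p) m =
      (\<Sum>d\<in>?D. if mono_degree m = d then Poly_Mapping.lookup p m else 0)"
    by (simp add: lookup_sum mono_part.rep_eq when_def)
  also have "\<dots> = (if mono_degree m \<in> ?D then Poly_Mapping.lookup p m else 0)"
    using finite_hcomponents[of p] by (rule sum.delta')
  also have "\<dots> = Poly_Mapping.lookup p m"
  proof (cases "mono_degree m \<in> ?D")
    case False
    then have "Poly_Mapping.lookup (hcomponent (mono_degree m) p) m = 0"
      by simp
    then show ?thesis
      by (simp add: mono_part.rep_eq)
  qed simp
  finally show "Poly_Mapping.lookup (\<Sum>d\<in>?D. hcomponent d p) m = Poly_Mapping.lookup p m" .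
qed

lemma poly_alg_finsum_hcomponents:
  assumes "p \<in> carrier (poly_alg A)"
  shows "(\<Oplus>\<^bsub>poly_alg A\<^esub>d\<in>{d. hcomponent d p \<noteq> 0}. hcomponent d p) = p"
proof -
  have "hcomponent d p \<in> carrier (poly_alg A)" for d
    using hcomponent_in_hpart[OF assms, of d] by (simp add: poly_alg_hpart)
  then show ?thesis
    by (simp add: poly_alg_finsum sum_hcomponents)
qed

theorem poly_alg_graded: "graded_algebra (ring_of_type_algebra :: 'k::field ring) (poly_alg A)"
proof (intro graded_algebra.intro graded_algebra_axioms.intro)
  interpret algebra "ring_of_type_algebra :: 'k ring" "poly_alg A"
    by (rule poly_alg_algebra)
  show "algebra (ring_of_type_algebra :: 'k ring) (poly_alg A)"
    by (rule poly_alg_algebra)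
  show "submodule (hpart (poly_alg A) d) (ring_of_type_algebra :: 'k ring) (poly_alg A)" for d
  proof (rule submoduleI)
    show "\<ominus>\<^bsub>poly_alg A\<^esub> p \<in> hpart (poly_alg A) d" if "p \<in> hpart (poly_alg A) d" for p
      using that by (simp add: poly_alg_hpart poly_alg_uminus poly_alg_closed)
    show "c \<odot>\<^bsub>poly_alg A\<^esub> p \<in> hpart (poly_alg A) d"
      if "p \<in> hpart (poly_alg A) d" for c p
      using that by (auto simp: poly_alg_hpart poly_alg_closed elim!: keys_mult_cases split: if_splits)
  qed (auto simp: poly_alg_hpart poly_alg_closed dest!: keys_add_cases)
  show "p \<otimes>\<^bsub>poly_alg A\<^esub> q \<in> hpart (poly_alg A) (d + e)"
    if "p \<in> hpart (poly_alg A) d" "q \<in> hpart (poly_alg A) e" for p q :: "('a, 'k) mpoly" and d e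
    using that by (auto simp: poly_alg_hpart poly_alg_closed mono_degree_plus elim!: keys_mult_cases)
  show "\<exists>!f. (\<forall>d. f d \<in> hpart (poly_alg A) d) \<and> finite {d. f d \<noteq> \<zero>\<^bsub>poly_alg A\<^esub>} \<and>
      p = (\<Oplus>\<^bsub>poly_alg A\<^esub>d\<in>{d. f d \<noteq> \<zero>\<^bsub>poly_alg A\<^esub>}. f d)"
    if p: "p \<in> carrier (poly_alg A)" for p :: "('a, 'k) mpoly"
  proof (rule ex1I[of _ "\<lambda>d. hcomponent d p"])
    show "(\<forall>d. hcomponent d p \<in> hpart (poly_alg A) d) \<and>
        finite {d. hcomponent d p \<noteq> \<zero>\<^bsub>poly_alg A\<^esub>} \<and>
        p = (\<Oplus>\<^bsub>poly_alg A\<^esub>d\<in>{d. hcomponent d p \<noteq> \<zero>\<^bsub>poly_alg A\<^esub>}. hcomponent d p)"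
      using p
      by (simp add: hcomponent_in_hpart finite_hcomponents poly_alg_finsum_hcomponents)
  next
    fix f
    assume f: "(\<forall>d. f d \<in> hpart (poly_alg A) d) \<and> finite {d. f d \<noteq> \<zero>\<^bsub>poly_alg A\<^esub>} \<and>
        p = (\<Oplus>\<^bsub>poly_alg A\<^esub>d\<in>{d. f d \<noteq> \<zero>\<^bsub>poly_alg A\<^esub>}. f d)"
    let ?D = "{d. f d \<noteq> 0}"
    have p_sum: "p = (\<Sum>d\<in>?D. f d)" and "finite ?D"
      using f by (simp_all add: poly_alg_finsum poly_alg_hpart)
    show "f = (\<lambda>d. hcomponent d p)"
    proof
      fix d
      have comp: "hcomponent d (f e) = (if e = d then f e else 0)" for e
        using f hcomponent_hpart[of "f e" A e d] by (simp add: when_def)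
      have "hcomponent d p = (\<Sum>e\<in>?D. hcomponent d (f e))"
        by (simp only: p_sum mono_part_sum)
      also have "\<dots> = (\<Sum>e\<in>?D. if e = d then f e else 0)"
        by (simp only: comp)
      also have "\<dots> = f d"
        using \<open>finite ?D\<close> by (simp add: sum.delta)
      finally show "f d = hcomponent d p"
        by simp
    qed
  qed
qed

text \<open>
  The elements of the ideal all of whose components lie in it form an ideal again: multiplication by
  a single term shifts the components, and every polynomial is a sum of terms.
\<close>
theorem homogeneous_ideal_genideal:
  fixes G :: "('a, 'k::field) mpoly set"
  assumes G: "\<And>g. g \<in> G \<Longrightarrow> \<exists>d. g \<in> hpart (poly_alg A) d"
  shows "homogeneous_ideal (genideal (poly_alg A) G) (poly_alg A)"
proof -
  interpret cring "poly_alg A :: ('k, ('a, 'k) mpoly) graded_alg"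
    by (rule poly_alg_cring)
  let ?I = "genideal (poly_alg A) G"
  have G_carrier: "G \<subseteq> carrier (poly_alg A)"
    using G by (auto simp: poly_alg_hpart)
  interpret I: ideal ?I "poly_alg A :: ('k, ('a, 'k) mpoly) graded_alg"
    by (rule genideal_ideal[OF G_carrier])
  have I_add: "p + q \<in> ?I" if "p \<in> ?I" "q \<in> ?I" for p q
    using I.a_closed[OF that] by simp
  have I_mult: "r * p \<in> ?I" if "p \<in> ?I" "r \<in> carrier (poly_alg A)" for p r
    using I.I_l_closed[OF that] by simp
  have I_uminus: "- p \<in> ?I" if "p \<in> ?I" for p
    using I.a_inv_closed[OF that] I.a_Hcarr[OF that] by (simp add: poly_alg_uminus)
  have I_zero: "0 \<in> ?I"
    using I.zero_closed by simp
  define J where "J = {p \<in> ?I. \<forall>d. hcomponent d p \<in> ?I}"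
  have J_mult: "r * p \<in> J" if p: "p \<in> J" and r: "r \<in> carrier (poly_alg A)" for p r
  proof (induction r rule: poly_mapping_additive_induct)
    case zero
    then show ?case
      by (simp add: J_def I_zero)
  next
    case (single m c)
    have "Poly_Mapping.single m c \<in> carrier (poly_alg A)"
      using single r by (simp add: poly_alg_carrier)
    moreover have "(\<lambda>n. mono_degree (m + n) = d) = (\<lambda>n. mono_degree n = d - mono_degree m)"
      if "mono_degree m \<le> d" for d
      using that by (auto simp: mono_degree_plus fun_eq_iff)
    moreover have "mono_part (\<lambda>n. mono_degree (m + n) = d) p = 0" if "\<not> mono_degree m \<le> d" for d
      using that by (intro mono_part_none) (simp add: mono_degree_plus)
    ultimately have "hcomponent d (Poly_Mapping.single m c * p) \<in> ?I" for d
      using p by (cases "mono_degree m \<le> d") (simp_all add: mono_part_single_mult I_mult I_zero J_def)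
    with \<open>Poly_Mapping.single m c \<in> carrier (poly_alg A)\<close> p show ?case
      by (simp add: J_def I_mult)
  next
    case (add f g)
    then show ?case
      by (simp add: J_def distrib_right mono_part_add I_add)
  qed
  have "ideal J (poly_alg A)"
  proof (rule idealI)
    show "ring (poly_alg A :: ('k, ('a, 'k) mpoly) graded_alg)"
      by (rule ring_axioms)
    show "subgroup J (add_monoid (poly_alg A))"
    proof (rule add.subgroupI)
      show "J \<subseteq> carrier (poly_alg A)"
        using I.a_subset by (auto simp: J_def)
      have "0 \<in> J"
        by (simp add: J_def I_zero)
      then show "J \<noteq> {}"
        by blast
      show "\<ominus>\<^bsub>poly_alg A\<^esub> p \<in> J" if "p \<in> J" for p
        using that I.a_Hcarr by (simp add: J_def poly_alg_uminus mono_part_uminus I_uminus)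
      show "p \<oplus>\<^bsub>poly_alg A\<^esub> q \<in> J" if "p \<in> J" "q \<in> J" for p q
        using that by (simp add: J_def mono_part_add I_add)
    qed
    show "r \<otimes>\<^bsub>poly_alg A\<^esub> p \<in> J" if "p \<in> J" "r \<in> carrier (poly_alg A)" for p r
      using J_mult[OF that] by simp
    show "p \<otimes>\<^bsub>poly_alg A\<^esub> r \<in> J" if "p \<in> J" "r \<in> carrier (poly_alg A)" for p r
      using J_mult[OF that] by (simp add: mult.commute)
  qed
  moreover have "G \<subseteq> J"
  proof
    fix g assume g: "g \<in> G"
    then obtain e where "g \<in> hpart (poly_alg A) e"
      using G by blast
    moreover have "g \<in> ?I"
      using genideal_self[OF G_carrier] g by blast
    ultimately show "g \<in> J"
      by (simp add: J_def hcomponent_hpart when_def I_zero)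
  qed
  ultimately have "?I \<subseteq> J"
    by (rule genideal_minimal)
  then have comp: "hcomponent d p \<in> ?I" if "p \<in> ?I" for p d
    using that by (auto simp: J_def)
  show ?thesis
    unfolding homogeneous_ideal_def
  proof (intro conjI ballI)
    show "ideal ?I (poly_alg A)"
      by (rule I.is_ideal)
    fix p assume p: "p \<in> ?I"
    then have "p \<in> carrier (poly_alg A)"
      by (rule I.a_Hcarr)
    with p comp show "\<exists>f. (\<forall>d. f d \<in> hpart (poly_alg A) d \<inter> ?I) \<and> finite {d. f d \<noteq> \<zero>\<^bsub>poly_alg A\<^esub>} \<and>
        p = (\<Oplus>\<^bsub>poly_alg A\<^esub>d\<in>{d. f d \<noteq> \<zero>\<^bsub>poly_alg A\<^esub>}. f d)"
      by (intro exI[of _ "\<lambda>d. hcomponent d p"])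
        (simp add: hcomponent_in_hpart finite_hcomponents poly_alg_finsum_hcomponents)
  qed
qed

section \<open>The retraction that kills the variables outside a set\<close>

lemma poly_alg_inclusion_hom:
  assumes "A \<subseteq> B"
  shows "(\<lambda>p. p) \<in> graded_algebra_hom (ring_of_type_algebra :: 'k::field ring) (poly_alg A) (poly_alg B)"
proof -
  have "p \<in> carrier (poly_alg B)" if "p \<in> carrier (poly_alg A)" for p :: "('a, 'k) mpoly"
    using that assms unfolding poly_alg_carrier by blast
  then show ?thesis
    unfolding graded_algebra_hom_def by (auto intro!: ring_hom_memI simp: poly_alg_hpart)
qed

lemma kill_variables_hom:
  "mono_part (involves_only A) \<in>
    graded_algebra_hom (ring_of_type_algebra :: 'k::field ring) (poly_alg B) (poly_alg A)"
proof -
  have mult: "mono_part (involves_only A) (p * q) =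
      mono_part (involves_only A) p * mono_part (involves_only A) q" for p q :: "('a, 'k) mpoly"
    by (rule mono_part_mult) (simp add: keys_plus_nat)
  have "mono_part (involves_only A) (1 :: ('a, 'k) mpoly) = 1"
    by (rule mono_part_all) (simp split: if_splits)
  with mult show ?thesis
    unfolding graded_algebra_hom_def
    by (auto intro!: ring_hom_memI
        simp: poly_alg_carrier poly_alg_hpart keys_mono_part mono_part_add mult)
qed

lemma kill_variables_indet:
  "mono_part (involves_only A) (indet a * indet b :: ('a, 'k::field) mpoly) =
    (indet a * indet b when a \<in> A \<and> b \<in> A)"
  by (simp add: indet_def mult_single keys_plus_nat conj_commute)

section \<open>Join-meet ideals\<close>

definition join_meet_binomials :: "'a::lattice set \<Rightarrow> ('a, 'k::field) mpoly set" where
  "join_meet_binomials A =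
    {indet a * indet b - indet (inf_class.inf a b) * indet (sup_class.sup a b) | a b.
      a \<in> A \<and> b \<in> A \<and> \<not> a \<le> b \<and> \<not> b \<le> a}"

lemma join_meet_ideal_eq: "join_meet_ideal A = genideal (poly_alg A) (join_meet_binomials A)"
  by (simp add: join_meet_ideal_def join_meet_binomials_def)

lemma indet_mult_hpart:
  "a \<in> A \<Longrightarrow> b \<in> A \<Longrightarrow> indet a * indet b \<in> hpart (poly_alg A) 2"
  by (auto simp: indet_def mult_single poly_alg_hpart poly_alg_carrier keys_plus_nat
      mono_degree_plus) (simp_all add: mono_degree_def)

lemma join_meet_binomials_hpart:
  assumes "sublattice A" "g \<in> join_meet_binomials A"
  shows "g \<in> hpart (poly_alg A) 2"
proof -
  obtain a b where ab: "a \<in> A" "b \<in> A"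
      and g: "g = indet a * indet b - indet (inf_class.inf a b) * indet (sup_class.sup a b)"
    using assms(2) by (auto simp: join_meet_binomials_def)
  have "indet a * indet b \<in> hpart (poly_alg A) 2"
    "indet (inf_class.inf a b) * indet (sup_class.sup a b) \<in> hpart (poly_alg A) 2"
    using assms(1) ab by (auto simp: sublattice_def intro!: indet_mult_hpart)
  then show ?thesis
    unfolding g by (rule poly_alg_hpart_diff)
qed

text \<open>
  If \<open>a\<close> and \<open>b\<close> lie in \<open>A\<close>, so do their meet and join, and the binomial is kept. Otherwise
  inducedness says that the meet and the join do not both lie in \<open>A\<close>, so both terms of the binomial
  are killed.
\<close>
lemma kill_variables_binomial:
  assumes "induced_sublattice A" "g \<in> join_meet_binomials UNIV"
  shows "mono_part (involves_only A) g \<in> insert 0 (join_meet_binomials A)"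
proof -
  obtain a b where ab: "\<not> a \<le> b" "\<not> b \<le> a"
      and g: "g = indet a * indet b - indet (inf_class.inf a b) * indet (sup_class.sup a b)"
    using assms(2) by (auto simp: join_meet_binomials_def)
  have both: "inf_class.inf a b \<in> A \<and> sup_class.sup a b \<in> A \<longleftrightarrow> a \<in> A \<and> b \<in> A"
    using assms(1) unfolding induced_sublattice_def sublattice_def by blast
  have "mono_part (involves_only A) g = (g when a \<in> A \<and> b \<in> A)"
    unfolding g diff_conv_add_uminus mono_part_add mono_part_uminus kill_variables_indet both
    by (simp add: when_def)
  moreover have "g \<in> join_meet_binomials A" if "a \<in> A \<and> b \<in> A"
    unfolding g join_meet_binomials_def using ab that by blast
  ultimately show ?thesis
    by (simp add: when_def)
qed

theorem proposition2p1:
  fixes L' :: "'a::{finite,lattice} set"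
  assumes "induced_sublattice L'"
  shows "\<exists>\<iota> :: ('a, 'k::field) mpoly set \<Rightarrow> ('a, 'k) mpoly set.
    (\<forall>p\<in>carrier (poly_alg L').
      \<iota> (join_meet_ideal L' +>\<^bsub>poly_alg L'\<^esub> p) =
        join_meet_ideal UNIV +>\<^bsub>poly_alg UNIV\<^esub> p) \<and>
    algebra_retract (ring_of_type_algebra :: 'k ring) \<iota>
      (join_meet_algebra L') (join_meet_algebra UNIV)"
proof -
  let ?K = "ring_of_type_algebra :: 'k ring"
  let ?S = "poly_alg UNIV :: ('k, ('a, 'k) mpoly) graded_alg"
  let ?S' = "poly_alg L' :: ('k, ('a, 'k) mpoly) graded_alg"
  let ?I = "join_meet_ideal UNIV :: ('a, 'k) mpoly set"
  let ?I' = "join_meet_ideal L' :: ('a, 'k) mpoly set"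
  let ?G = "join_meet_binomials UNIV :: ('a, 'k) mpoly set"
  let ?G' = "join_meet_binomials L' :: ('a, 'k) mpoly set"
  let ?e = "mono_part (involves_only L') :: ('a, 'k) mpoly \<Rightarrow> ('a, 'k) mpoly"
  have "sublattice L'"
    using assms by (simp add: induced_sublattice_def)
  have "sublattice (UNIV :: 'a set)"
    by (simp add: sublattice_def)
  have homog: "homogeneous_ideal ?I' ?S'" "homogeneous_ideal ?I ?S"
    unfolding join_meet_ideal_eq
    using join_meet_binomials_hpart \<open>sublattice L'\<close> \<open>sublattice (UNIV :: 'a set)\<close>
    by (blast intro: homogeneous_ideal_genideal)+
  then have ideals: "ideal ?I' ?S'" "ideal ?I ?S"
    by (simp_all add: homogeneous_ideal_def)
  have G_carrier: "?G' \<subseteq> carrier ?S'" "?G \<subseteq> carrier ?S"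
    using join_meet_binomials_hpart[OF \<open>sublattice L'\<close>]
      join_meet_binomials_hpart[OF \<open>sublattice (UNIV :: 'a set)\<close>] poly_alg_hpart by blast+
  interpret S': cring ?S' by (rule poly_alg_cring)
  interpret S: cring ?S by (rule poly_alg_cring)
  have i_hom: "(\<lambda>p. p) \<in> graded_algebra_hom ?K ?S' ?S"
    by (rule poly_alg_inclusion_hom) simp
  have e_hom: "?e \<in> graded_algebra_hom ?K ?S ?S'"
    by (rule kill_variables_hom)
  interpret i: ring_hom_ring ?S' ?S "\<lambda>p. p"
    using i_hom by (intro ring_hom_ringI2 S.ring_axioms S'.ring_axioms) (simp add: graded_algebra_hom_def)
  interpret e: ring_hom_ring ?S ?S' ?e
    using e_hom by (intro ring_hom_ringI2 S.ring_axioms S'.ring_axioms) (simp add: graded_algebra_hom_def)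
  have "?G' \<subseteq> ?G"
    by (auto simp: join_meet_binomials_def)
  then have "(\<lambda>p. p) ` ?G' \<subseteq> ?I"
    using S.genideal_self[OF G_carrier(2)] by (auto simp: join_meet_ideal_eq)
  then have i_ideal: "(\<lambda>p. p) ` ?I' \<subseteq> ?I"
    unfolding join_meet_ideal_eq[of L'] by (rule i.image_genideal_subset[OF ideals(2) G_carrier(1)])
  have "0 \<in> ?I'"
    using additive_subgroup.zero_closed[OF ideal.axioms(1)[OF ideals(1)]] by simp
  then have "insert 0 ?G' \<subseteq> ?I'"
    using S'.genideal_self[OF G_carrier(1)] by (simp add: join_meet_ideal_eq)
  then have "?e ` ?G \<subseteq> ?I'"
    using kill_variables_binomial[OF assms] by blast
  then have e_ideal: "?e ` ?I \<subseteq> ?I'"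
    unfolding join_meet_ideal_eq[of UNIV] by (rule e.image_genideal_subset[OF ideals(1) G_carrier(2)])
  have "?e p = p" if "p \<in> carrier ?S'" for p
    using that by (intro mono_part_all) (simp add: poly_alg_carrier)
  then show ?thesis
    unfolding join_meet_algebra_def
    by (rule algebra_retract_quot[OF poly_alg_graded poly_alg_graded homog i_hom e_hom _ i_ideal e_ideal])
qed

end
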